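(* Let $0<\mu<L$ and $\kappa=L/\mu$. For $\nu\in(-4/L,0)$ let $$\ell(\lambda,\eta)=\lambda^2-\eta(a_1\lambda+a_0)-(b_1\lambda+b_0)$$ with real $a_0,a_1,b_0,b_1$ determined by requiring the polynomial identities in $\lambda$ $$\ell(\lambda,\mu)=\left(\lambda-(1-\sqrt{-\nu\mu})\right)^2,\qquad \ell(\lambda,L)=\left(\lambda-(1-\sqrt{-\nu L})\right)^2.$$ Then $$a_1=\frac{-2\sqrt{-\nu}}{\sqrt{\mu}+\sqrt{L}},\qquad a_0=\frac{2\sqrt{-\nu}}{\sqrt{\mu}+\sqrt{L}}+\nu .$$ Moreover, considering the associated algorithm $$\mathbf{x}^{k+1}=(a_1A+b_1I_d)\mathbf{x}^{k}+(a_0A+b_0I_d)\mathbf{x}^{k-1}+\nu\mathbf{b}$$ for minimizing $f_{A,\mathbf{b}}(\mathbf{x})=\frac12\mathbf{x}^\top A\mathbf{x}+\mathbf{b}^\top\mathbf{x}$, where $A$ is any real symmetric $d\times d$ matrix with spectrum in $[\mu,L]$ and $\mathbf{b}\in\mathbb{R}^d$: (i) if $\nu=-1/L$, this is exactly the Accelerated Gradient Descent iteration for $f_{A,\mathbf{b}}$, and $\rho_\lambda(\ell(\lambda,\eta))\le\frac{\sqrt{\kappa}-1}{\sqrt{\kappa}}$ for all $\eta\in[\mu,L]$; (ii) if $\nu=-\left(\frac{2}{\sqrt{L}+\sqrt{\mu}}\right)^2$, this is exactly the Heavy Ball iteration for $f_{A,\mathbf{b}}$, and $\rho_\lambda(\ell(\lambda,\eta))\le\frac{\sqrt{\kappa}-1}{\sqrt{\kappa}+1}$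 for all $\eta\in[\mu,L]$.
   Context: For fixed $\eta$, $\rho_\lambda(\ell(\lambda,\eta))$ denotes the maximum modulus of the complex roots of $\lambda\mapsto\ell(\lambda,\eta)$. Accelerated Gradient Descent (AGD) for an $L$-smooth $\mu$-strongly convex $f$ is: $\mathbf{y}^{k+1}=\mathbf{x}^k-\frac1L\nabla f(\mathbf{x}^k)$, $\mathbf{x}^{k+1}=(1+\alpha)\mathbf{y}^{k+1}-\alpha\mathbf{y}^k$, $\alpha=\frac{\sqrt L-\sqrt\mu}{\sqrt L+\sqrt\mu}$; eliminating $\mathbf{y}$, its iteration is $$\mathbf{x}^{k+1}=(1+\alpha)\left(\mathbf{x}^k-\tfrac1L\nabla f(\mathbf{x}^k)\right)-\alpha\left(\mathbf{x}^{k-1}-\tfrac1L\nabla f(\mathbf{x}^{k-1})\right).$$ The Heavy Ball (HB) iteration is $$\mathbf{x}^{k+1}=\mathbf{x}^k-\alpha'\nabla f(\mathbf{x}^k)+\beta'(\mathbf{x}^k-\mathbf{x}^{k-1}),\qquad \alpha'=\frac{4}{(\sqrt L+\sqrt\mu)^2},\quad \beta'=\left(\frac{\sqrt L-\sqrt\mu}{\sqrt L+\sqrt\mu}\right)^2.$$ For the quadratic $f_{A,\mathbf{b}}$, $\nabla f_{A,\mathbf{b}}(\mathbf{x})=A\mathbf{x}+\mathbf{b}$. *)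

theory Defs
  imports "HOL-Analysis.Analysis" "HOL-Computational_Algebra.Polynomial"
begin

section \<open>The polynomial family and its root radius\<close>

text \<open>For fixed \<open>\<eta>\<close>, \<open>\<ell>(\<cdot>, \<eta>)\<close> is a real polynomial in \<open>\<lambda>\<close>; coefficient lists start with the
  constant term.\<close>

definition ell :: "real \<Rightarrow> real \<Rightarrow> real \<Rightarrow> real \<Rightarrow> real \<Rightarrow> real poly" where
  "ell a1 a0 b1 b0 \<eta> = [:0, 0, 1:] - smult \<eta> [:a0, a1:] - [:b0, b1:]"

text \<open>\<open>Max\<close> is meaningful for polynomials of positive degree, where the set of complex roots is finite
  and nonempty; \<open>ell\<close> always has degree 2.\<close>

definition root_radius :: "real poly \<Rightarrow> real" where
  "root_radius p = Max (cmod ` {z. poly (map_poly complex_of_real p) z = 0})"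

definition interpolates :: "real \<Rightarrow> real \<Rightarrow> real \<Rightarrow> real \<Rightarrow> real \<Rightarrow> real \<Rightarrow> real \<Rightarrow> bool" where
  "interpolates \<mu> L \<nu> a1 a0 b1 b0 \<longleftrightarrow>
     ell a1 a0 b1 b0 \<mu> = [:- (1 - sqrt (- \<nu> * \<mu>)), 1:] ^ 2 \<and>
     ell a1 a0 b1 b0 L = [:- (1 - sqrt (- \<nu> * L)), 1:] ^ 2"

section \<open>Quadratic objectives\<close>

definition quad :: "real^'d^'d \<Rightarrow> real^'d \<Rightarrow> real^'d \<Rightarrow> real" where
  "quad A b x = 1 / 2 * (x \<bullet> (A *v x)) + b \<bullet> x"

text \<open>Real eigenvalues suffice here, since the matrices concerned are symmetric.\<close>

definition spectrum :: "real^'d^'d \<Rightarrow> real set" where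
  "spectrum A = {c. \<exists>v. v \<noteq> 0 \<and> A *v v = c *\<^sub>R v}"

definition grad :: "('a::real_inner \<Rightarrow> real) \<Rightarrow> 'a \<Rightarrow> 'a" where
  "grad f x = (THE D. GDERIV f x :> D)"

lemma GDERIV_unique:
  fixes f :: "'a::real_inner \<Rightarrow> real"
  assumes "GDERIV f x :> D" "GDERIV f x :> E"
  shows "D = E"
proof -
  have "(\<lambda>h. h \<bullet> D) = (\<lambda>h. h \<bullet> E)"
    using assms unfolding gderiv_def by (rule has_derivative_unique)
  then have "(D - E) \<bullet> D = (D - E) \<bullet> E"
    by (rule fun_cong)
  then have "(D - E) \<bullet> (D - E) = 0"
    by (simp only: inner_diff_right diff_self)
  then show ?thesis by simp
qed

lemma grad_quad:
  fixes A :: "real^'d^'d"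
  assumes "transpose A = A"
  shows "grad (quad A b) x = A *v x + b"
proof -
  have sym: "x \<bullet> (A *v h) = h \<bullet> (A *v x)" for h
  proof -
    have "x \<bullet> (A *v h) = (x v* A) \<bullet> h"
      by (simp only: dot_lmul_matrix)
    also have "x v* A = A *v x"
      using vector_transpose_matrix[of x A] assms by simp
    finally show ?thesis by (simp only: inner_commute)
  qed
  have lin: "((\<lambda>x. A *v x) has_derivative (\<lambda>h. A *v h)) (at x)"
    by (intro bounded_linear_imp_has_derivative matrix_vector_mul_bounded_linear)
  have "GDERIV (quad A b) x :> A *v x + b"
    unfolding gderiv_def quad_def
    by (rule has_derivative_eq_rhs, (rule derivative_intros lin)+)
       (auto simp: fun_eq_iff sym inner_add_right inner_commute)
  then show ?thesis
    unfolding grad_def by (metis the_equality GDERIV_unique)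
qed

section \<open>The algorithms\<close>

text \<open>All step functions take the current and the previous iterate, in this order.\<close>

definition quad_step ::
  "real \<Rightarrow> real \<Rightarrow> real \<Rightarrow> real \<Rightarrow> real \<Rightarrow> real^'d^'d \<Rightarrow> real^'d \<Rightarrow> real^'d \<Rightarrow> real^'d \<Rightarrow> real^'d" where
  "quad_step a1 a0 b1 b0 \<nu> A b x x' =
     (a1 *\<^sub>R A + b1 *\<^sub>R mat 1) *v x + (a0 *\<^sub>R A + b0 *\<^sub>R mat 1) *v x' + \<nu> *\<^sub>R b"

definition agd_momentum :: "real \<Rightarrow> real \<Rightarrow> real" where
  "agd_momentum L \<mu> = (sqrt L - sqrt \<mu>) / (sqrt L + sqrt \<mu>)"

definition agd_step :: "real \<Rightarrow> real \<Rightarrow> ('a::real_inner \<Rightarrow> real) \<Rightarrow> 'a \<Rightarrow> 'a \<Rightarrow> 'a" where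
  "agd_step L \<mu> f x x' =
     (1 + agd_momentum L \<mu>) *\<^sub>R (x - (1 / L) *\<^sub>R grad f x)
     - agd_momentum L \<mu> *\<^sub>R (x' - (1 / L) *\<^sub>R grad f x')"

definition hb_step :: "real \<Rightarrow> real \<Rightarrow> ('a::real_inner \<Rightarrow> real) \<Rightarrow> 'a \<Rightarrow> 'a \<Rightarrow> 'a" where
  "hb_step L \<mu> f x x' =
     x - (4 / (sqrt L + sqrt \<mu>)^2) *\<^sub>R grad f x
     + ((sqrt L - sqrt \<mu>) / (sqrt L + sqrt \<mu>))^2 *\<^sub>R (x - x')"

text \<open>The two-sequence form of accelerated gradient descent; \<open>agd_run_iff_step\<close> shows that
  \<open>agd_step\<close> is exactly what remains after eliminating \<open>y\<close>.\<close>

definition agd_run ::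
  "real \<Rightarrow> real \<Rightarrow> ('a::real_inner \<Rightarrow> real) \<Rightarrow> (nat \<Rightarrow> 'a) \<Rightarrow> (nat \<Rightarrow> 'a) \<Rightarrow> bool" where
  "agd_run L \<mu> f x y \<longleftrightarrow>
     (\<forall>k. y (Suc k) = x k - (1 / L) *\<^sub>R grad f (x k) \<and>
          x (Suc k) = (1 + agd_momentum L \<mu>) *\<^sub>R y (Suc k) - agd_momentum L \<mu> *\<^sub>R y k)"

lemma agd_run_iff_step:
  assumes "0 < \<mu>" "\<mu> < L"
  shows "(\<exists>y. agd_run L \<mu> f x y) \<longleftrightarrow>
         (\<forall>k. x (Suc (Suc k)) = agd_step L \<mu> f (x (Suc k)) (x k))"
proof
  assume "\<exists>y. agd_run L \<mu> f x y"
  then show "\<forall>k. x (Suc (Suc k)) = agd_step L \<mu> f (x (Suc k)) (x k)"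
    unfolding agd_run_def agd_step_def by auto
next
  assume step: "\<forall>k. x (Suc (Suc k)) = agd_step L \<mu> f (x (Suc k)) (x k)"
  define m where "m = agd_momentum L \<mu>"
  have "sqrt L - sqrt \<mu> > 0" "sqrt L + sqrt \<mu> > 0"
    using assms by (auto intro: add_pos_pos)
  then have m: "m \<noteq> 0"
    unfolding m_def agd_momentum_def by (metis divide_eq_0_iff less_irrefl)
  define g where "g k = x k - (1 / L) *\<^sub>R grad f (x k)" for k
  define y where
    "y k = (case k of 0 \<Rightarrow> (1 / m) *\<^sub>R ((1 + m) *\<^sub>R g 0 - x 1) | Suc j \<Rightarrow> g j)" for k
  have "x (Suc k) = (1 + m) *\<^sub>R y (Suc k) - m *\<^sub>R y k" for k
  proof (cases k)
    case 0
    then show ?thesis using m by (simp add: y_def)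
  next
    case (Suc j)
    then show ?thesis using step by (simp add: y_def g_def agd_step_def m_def)
  qed
  then have "agd_run L \<mu> f x y"
    unfolding agd_run_def m_def[symmetric] by (simp add: y_def g_def)
  then show "\<exists>y. agd_run L \<mu> f x y"
    by (rule exI[of _ y])
qed

end

theory Submission
  imports Defs "HOL-Computational_Algebra.Fundamental_Theorem_Algebra"
begin

text \<open>With \<open>s = sqrt (- \<nu>)\<close>, the discriminant of \<open>\<ell>(\<cdot>, \<eta>)\<close> is
  \<open>4 s\<^sup>2 (\<eta> - \<mu>) (\<eta> - L) / (sqrt \<mu> + sqrt L)\<^sup>2\<close>, which is nonpositive on \<open>[\<mu>, L]\<close>. The two roots are
  therefore complex conjugates (or equal), so their squared modulus is the constant coefficient of
  \<open>\<ell>(\<cdot>, \<eta>)\<close>. This is affine in \<open>\<eta>\<close> and hence bounded by its values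
  \<open>(1 - s sqrt \<mu>)\<^sup>2\<close> and \<open>(1 - s sqrt L)\<^sup>2\<close> at the endpoints.\<close>

text \<open>Splitting the equation into real and imaginary parts avoids the quadratic formula: the
  imaginary part factors as \<open>y * (2 * x + p)\<close>, and both cases lead to
  \<open>p = - 2 * x\<close>.\<close>

lemma cmod_root_nonpos_discrim:
  fixes p q :: real and z :: complex
  assumes root: "z\<^sup>2 + of_real p * z + of_real q = 0" and disc: "p\<^sup>2 \<le> 4 * q"
  shows "(cmod z)\<^sup>2 = q"
proof -
  obtain x y where z: "z = Complex x y" by (cases z)
  have re: "x\<^sup>2 - y\<^sup>2 + p * x + q = 0" and im: "y * (2 * x + p) = 0"
    using root by (auto simp: z complex_eq_iff power2_eq_square algebra_simps)
  have "x\<^sup>2 + y\<^sup>2 = q"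
  proof (cases "y = 0")
    case True
    \<comment> \<open>At a real root the discriminant is a square, so \<open>disc\<close> forces it
      to vanish.\<close>
    have "(2 * x + p)\<^sup>2 = p\<^sup>2 - 4 * q"
      using re True by (simp add: power2_eq_square algebra_simps)
    then have "(2 * x + p)\<^sup>2 = 0"
      using disc zero_le_power2[of "2 * x + p"] by linarith
    then have "p = - 2 * x" by simp
    then show ?thesis
      using re True by (simp add: power2_eq_square)
  next
    case False
    then have "p = - 2 * x" using im by simp
    then show ?thesis
      using re by (simp add: power2_eq_square)
  qed
  then show ?thesis by (simp add: z cmod_power2)
qed

text \<open>Bounding \<open>Max\<close> needs a finite nonempty set: finiteness comes from the
  polynomial being nonzero, a root from the fundamental theorem of algebra.\<close>

lemma root_radius_le:
  fixes p q r :: real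
  assumes "p\<^sup>2 \<le> 4 * q" "q \<le> r\<^sup>2" "0 \<le> r"
  shows "root_radius [:q, p, 1:] \<le> r"
proof -
  let ?P = "map_poly complex_of_real [:q, p, 1:]"
  have P: "?P = [:of_real q, of_real p, 1:]"
    by (simp add: map_poly_pCons)
  have "finite {z. poly ?P z = 0}"
    unfolding P by (intro poly_roots_finite) simp
  moreover have "\<exists>z. poly ?P z = 0"
    by (rule fundamental_theorem_of_algebra_alt) (auto simp: P)
  moreover have "cmod z \<le> r" if "poly ?P z = 0" for z
  proof -
    have "z\<^sup>2 + of_real p * z + of_real q = 0"
      using that unfolding P by (simp add: power2_eq_square algebra_simps)
    from cmod_root_nonpos_discrim[OF this assms(1)] show ?thesis
      using assms(2,3) by (metis power2_le_imp_le)
  qed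
  ultimately show ?thesis
    unfolding root_radius_def by (subst Max_le_iff) auto
qed

lemma ell_eq: "ell a1 a0 b1 b0 \<eta> = [:- (\<eta> * a0 + b0), - (\<eta> * a1 + b1), 1:]"
  by (simp add: ell_def)

text \<open>Comparing coefficients yields two decoupled linear systems, one for
  \<open>a1, b1\<close> and one for \<open>a0, b0\<close>.\<close>

lemma interpolates_iff_equations:
  "interpolates \<mu> L \<nu> a1 a0 b1 b0 \<longleftrightarrow>
     \<mu> * a1 + b1 = 2 * (1 - sqrt (- \<nu>) * sqrt \<mu>) \<and>
     L * a1 + b1 = 2 * (1 - sqrt (- \<nu>) * sqrt L) \<and>
     \<mu> * a0 + b0 = - ((1 - sqrt (- \<nu>) * sqrt \<mu>)\<^sup>2) \<and>
     L * a0 + b0 = - ((1 - sqrt (- \<nu>) * sqrt L)\<^sup>2)"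
  unfolding interpolates_def ell_eq real_sqrt_mult
  by (auto simp: power2_eq_square algebra_simps)

text \<open>Subtracting the two equations isolates the slope. As an equivalence, this turns a
  verified solution into the only one.\<close>

lemma affine_through_two_points_iff:
  fixes u v a b c d :: real
  assumes "u \<noteq> v" "u * c + d = g" "v * c + d = h"
  shows "u * a + b = g \<and> v * a + b = h \<longleftrightarrow> a = c \<and> b = d"
proof
  assume eqs: "u * a + b = g \<and> v * a + b = h"
  have "(u - v) * (a - c) = 0"
    using eqs assms(2,3) by (simp add: algebra_simps)
  then show "a = c \<and> b = d"
    using eqs assms by auto
qed (use assms in auto)

text \<open>The slopes are divided differences over \<open>\<mu> - L = (m - l) * (m + l)\<close>;
  the factor \<open>m - l\<close> cancels, leaving the denominator \<open>m + l\<close>.\<close>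

lemma interpolates_iff:
  fixes \<mu> L \<nu> :: real
  defines "m \<equiv> sqrt \<mu>" and "l \<equiv> sqrt L" and "s \<equiv> sqrt (- \<nu>)"
  assumes "0 < \<mu>" "\<mu> < L" "\<nu> < 0"
  shows "interpolates \<mu> L \<nu> a1 a0 b1 b0 \<longleftrightarrow>
     a1 = - 2 * s / (m + l) \<and> a0 = 2 * s / (m + l) + \<nu> \<and>
     b1 = 2 - 2 * s * m * l / (m + l) \<and> b0 = - 1 + 2 * s * m * l / (m + l)"
proof -
  have pos: "0 < m" "0 < l" and mu: "\<mu> = m\<^sup>2" and L: "L = l\<^sup>2" and nu: "\<nu> = - s\<^sup>2"
    using assms by auto
  \<comment> \<open>Writing \<open>s\<close> as \<open>w * (m + l)\<close> makes the interpolation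
    conditions polynomial identities, free of division.\<close>
  define w where "w = s / (m + l)"
  have s: "s = w * (m + l)" using pos by (simp add: w_def)
  have 1: "\<mu> * a1 + b1 = 2 * (1 - s * m) \<and> L * a1 + b1 = 2 * (1 - s * l) \<longleftrightarrow>
      a1 = - 2 * w \<and> b1 = 2 - 2 * w * m * l"
    by (rule affine_through_two_points_iff)
       (use assms(5) in \<open>simp_all add: mu L s algebra_simps power2_eq_square\<close>)
  have 2: "\<mu> * a0 + b0 = - ((1 - s * m)\<^sup>2) \<and> L * a0 + b0 = - ((1 - s * l)\<^sup>2) \<longleftrightarrow>
      a0 = 2 * w + \<nu> \<and> b0 = - 1 + 2 * w * m * l"
    by (rule affine_through_two_points_iff)
       (use assms(5) in \<open>simp_all add: mu L nu s algebra_simps power2_eq_square\<close>)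
  show ?thesis
    unfolding interpolates_iff_equations m_def[symmetric] l_def[symmetric] s_def[symmetric]
    using 1 2 by (auto simp: w_def)
qed

lemma root_radius_interpolating_le:
  fixes \<mu> L \<nu> r :: real
  assumes pos: "0 < \<mu>" "\<mu> < L" "\<nu> < 0"
    and int: "interpolates \<mu> L \<nu> a1 a0 b1 b0"
    and \<eta>: "\<eta> \<in> {\<mu>..L}"
    and r: "0 \<le> r" "\<bar>1 - sqrt (- \<nu>) * sqrt \<mu>\<bar> \<le> r" "\<bar>1 - sqrt (- \<nu>) * sqrt L\<bar> \<le> r"
  shows "root_radius (ell a1 a0 b1 b0 \<eta>) \<le> r"
proof -
  define m l s where "m = sqrt \<mu>" and "l = sqrt L" and "s = sqrt (- \<nu>)"
  have ml: "0 < m" "0 < l" and mu: "\<mu> = m\<^sup>2" and L: "L = l\<^sup>2" and nu: "\<nu> = - s\<^sup>2"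
    using pos by (auto simp: m_def l_def s_def)
  \<comment> \<open>Chosen so that the roots sum to \<open>2 - 2 * t\<close>; the discriminant is
    then \<open>4 * (t\<^sup>2 - s\<^sup>2 * \<eta>)\<close>.\<close>
  define t where "t = s * (\<eta> + m * l) / (m + l)"
  have nz: "m + l \<noteq> 0" using ml by linarith
  define w where "w = s / (m + l)"
  have ab: "a1 = - 2 * w" "a0 = 2 * w - s\<^sup>2" "b1 = 2 - 2 * w * m * l" "b0 = - 1 + 2 * w * m * l"
    using int unfolding interpolates_iff[OF pos] m_def[symmetric] l_def[symmetric] s_def[symmetric]
    by (auto simp: w_def nu)
  have "t = w * (\<eta> + m * l)"
    by (simp add: t_def w_def)
  then have coeffs:
    "\<eta> * a1 + b1 = 2 - 2 * t" "- (\<eta> * a0 + b0) = 1 - 2 * t + s\<^sup>2 * \<eta>"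
    by (simp_all add: ab algebra_simps)
  have "(\<eta> + m * l)\<^sup>2 - \<eta> * (m + l)\<^sup>2 = (\<eta> - \<mu>) * (\<eta> - L)"
    by (simp add: mu L power2_eq_square algebra_simps)
  also have "\<dots> \<le> 0"
    using \<eta> by (intro mult_nonneg_nonpos) auto
  finally have "(\<eta> + m * l)\<^sup>2 / (m + l)\<^sup>2 \<le> \<eta>"
    using nz by (simp add: pos_divide_le_eq)
  then have t: "t\<^sup>2 \<le> s\<^sup>2 * \<eta>"
    unfolding t_def power_divide power_mult_distrib times_divide_eq_right[symmetric]
    by (rule mult_left_mono) simp
  then have disc: "(- (\<eta> * a1 + b1))\<^sup>2 \<le> 4 * - (\<eta> * a0 + b0)"
    unfolding coeffs by (simp add: power2_eq_square algebra_simps)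
  \<comment> \<open>At each endpoint the constant coefficient is the square of the double
    root.\<close>
  have ends: "- (\<mu> * a0 + b0) \<le> r\<^sup>2" "- (L * a0 + b0) \<le> r\<^sup>2"
    using int r abs_le_square_iff[of _ r] by (auto simp: interpolates_iff_equations)
  have "- (\<eta> * a0 + b0) \<le> r\<^sup>2"
  \<comment> \<open>The sign of \<open>a0\<close> decides which endpoint maximises the affine
    constant coefficient.\<close>
  proof (cases "0 \<le> a0")
    case True
    then have "\<mu> * a0 \<le> \<eta> * a0" using \<eta> by (intro mult_right_mono) auto
    then show ?thesis using ends by linarith
  next
    case False
    then have "L * a0 \<le> \<eta> * a0" using \<eta> by (intro mult_right_mono_neg) auto
    then show ?thesis using ends by linarith
  qed
  then show ?thesis
    unfolding ell_eq using disc r(1) by (intro root_radius_le)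
qed

lemma quad_step_eq:
  "quad_step a1 a0 b1 b0 \<nu> A b x x' =
     a1 *\<^sub>R (A *v x) + b1 *\<^sub>R x + a0 *\<^sub>R (A *v x') + b0 *\<^sub>R x' + \<nu> *\<^sub>R b"
  by (simp add: quad_step_def matrix_vector_mult_add_rdistrib scaleR_matrix_vector_assoc[symmetric])

text \<open>The coefficients collect the terms in the two iterates and their images under
  \<open>A\<close>. The terms in \<open>b\<close> add up to \<open>- 1 / L\<close> because the
  weights \<open>1 + agd_momentum L \<mu>\<close> and \<open>- agd_momentum L \<mu>\<close> sum to
  one.\<close>

lemma quad_step_eq_agd_step:
  fixes A :: "real^'d^'d"
  assumes "transpose A = A"
    and "a1 = - (1 + agd_momentum L \<mu>) / L" "b1 = 1 + agd_momentum L \<mu>"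
    and "a0 = agd_momentum L \<mu> / L" "b0 = - agd_momentum L \<mu>" "\<nu> = - 1 / L"
  shows "quad_step a1 a0 b1 b0 \<nu> A b x x' = agd_step L \<mu> (quad A b) x x'"
  unfolding quad_step_eq agd_step_def grad_quad[OF assms(1)] assms(2-)
  by (simp add: vec_eq_iff add_divide_distrib diff_divide_distrib algebra_simps)

text \<open>Heavy Ball evaluates the gradient only at the current iterate, hence
  \<open>a0 = 0\<close>.\<close>

lemma quad_step_eq_hb_step:
  fixes A :: "real^'d^'d" and \<mu> L :: real
  defines "\<alpha> \<equiv> 4 / (sqrt L + sqrt \<mu>)\<^sup>2"
    and "\<beta> \<equiv> ((sqrt L - sqrt \<mu>) / (sqrt L + sqrt \<mu>))\<^sup>2"
  assumes "transpose A = A"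
    and "a1 = - \<alpha>" "b1 = 1 + \<beta>" "a0 = 0" "b0 = - \<beta>" "\<nu> = - \<alpha>"
  shows "quad_step a1 a0 b1 b0 \<nu> A b x x' = hb_step L \<mu> (quad A b) x x'"
  unfolding quad_step_eq hb_step_def grad_quad[OF assms(3)] assms(4-)
    \<alpha>_def[symmetric] \<beta>_def[symmetric]
  by (simp add: vec_eq_iff algebra_simps)

text \<open>The unique existence clause says that the interpolation conditions determine the
  coefficients, so the universally quantified claims concern exactly one tuple.\<close>

theorem mainTheorem5:
  fixes \<mu> L \<kappa> \<nu> :: real
  assumes "0 < \<mu>" and "\<mu> < L" and "\<kappa> = L / \<mu>"
    and "\<nu> \<in> {-4 / L <..< 0}"
  shows "(\<exists>!(a1, a0, b1, b0). interpolates \<mu> L \<nu> a1 a0 b1 b0) \<and>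
    (\<forall>a1 a0 b1 b0. interpolates \<mu> L \<nu> a1 a0 b1 b0 \<longrightarrow>
       a1 = - 2 * sqrt (- \<nu>) / (sqrt \<mu> + sqrt L) \<and>
       a0 = 2 * sqrt (- \<nu>) / (sqrt \<mu> + sqrt L) + \<nu> \<and>
       (\<nu> = - 1 / L \<longrightarrow>
          (\<forall>(A :: real^'d^'d) b. transpose A = A \<and> spectrum A \<subseteq> {\<mu>..L} \<longrightarrow>
             (\<forall>x x'. quad_step a1 a0 b1 b0 \<nu> A b x x' = agd_step L \<mu> (quad A b) x x')) \<and>
          (\<forall>\<eta>\<in>{\<mu>..L}. root_radius (ell a1 a0 b1 b0 \<eta>) \<le> (sqrt \<kappa> - 1) / sqrt \<kappa>)) \<and>
       (\<nu> = - ((2 / (sqrt L + sqrt \<mu>))^2) \<longrightarrow>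
          (\<forall>(A :: real^'d^'d) b. transpose A = A \<and> spectrum A \<subseteq> {\<mu>..L} \<longrightarrow>
             (\<forall>x x'. quad_step a1 a0 b1 b0 \<nu> A b x x' = hb_step L \<mu> (quad A b) x x')) \<and>
          (\<forall>\<eta>\<in>{\<mu>..L}. root_radius (ell a1 a0 b1 b0 \<eta>) \<le> (sqrt \<kappa> - 1) / (sqrt \<kappa> + 1))))"
proof -
  define m l s where "m = sqrt \<mu>" and "l = sqrt L" and "s = sqrt (- \<nu>)"
  have nu0: "\<nu> < 0" using assms(4) by simp
  have ml: "0 < m" "m < l" and L: "L = l\<^sup>2"
    using assms by (auto simp: m_def l_def)
  have nz: "m \<noteq> 0" "l \<noteq> 0" "m + l \<noteq> 0" using ml by auto
  have kappa: "sqrt \<kappa> = l / m"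
    by (simp add: assms(3) real_sqrt_divide m_def l_def)
  have kappa_agd: "(sqrt \<kappa> - 1) / sqrt \<kappa> = 1 - m / l"
    using nz by (simp add: kappa field_simps)
  have kappa_hb: "(sqrt \<kappa> - 1) / (sqrt \<kappa> + 1) = (l - m) / (l + m)"
  proof -
    have "sqrt \<kappa> - 1 = (l - m) / m" "sqrt \<kappa> + 1 = (l + m) / m"
      using nz by (simp_all add: kappa field_simps)
    then show ?thesis using nz by simp
  qed
  note iff = interpolates_iff[OF assms(1,2) nu0, folded m_def l_def s_def]
  have ex1: "\<exists>!(a1, a0, b1, b0). interpolates \<mu> L \<nu> a1 a0 b1 b0"
    unfolding iff by (rule ex1I) auto
  have agd: "(\<forall>(A :: real^'d^'d) b. transpose A = A \<and> spectrum A \<subseteq> {\<mu>..L} \<longrightarrow>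
        (\<forall>x x'. quad_step a1 a0 b1 b0 \<nu> A b x x' = agd_step L \<mu> (quad A b) x x')) \<and>
      (\<forall>\<eta>\<in>{\<mu>..L}. root_radius (ell a1 a0 b1 b0 \<eta>) \<le> (sqrt \<kappa> - 1) / sqrt \<kappa>)"
    if int: "interpolates \<mu> L \<nu> a1 a0 b1 b0" and nu: "\<nu> = - 1 / L" for a1 a0 b1 b0
  proof -
    have s: "s = 1 / l"
      by (simp add: s_def nu l_def real_sqrt_divide)
    \<comment> \<open>This form exposes \<open>1 + agd_momentum L \<mu>\<close>, to be matched with
      \<open>b1 = 2 - 2 * m / (m + l)\<close>.\<close>
    have mom: "agd_momentum L \<mu> = 2 * l / (m + l) - 1"
      using nz by (simp add: agd_momentum_def m_def l_def field_simps)
    have "2 - 2 * m / (m + l) = 2 * l / (m + l)"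
      using nz by (simp add: field_simps)
    then have "a1 = - (1 + agd_momentum L \<mu>) / L" "b1 = 1 + agd_momentum L \<mu>"
      "a0 = agd_momentum L \<mu> / L" "b0 = - agd_momentum L \<mu>"
      using int nz unfolding iff mom by (auto simp: s nu L diff_divide_distrib power2_eq_square)
    \<comment> \<open>With \<open>s = 1 / l\<close> the double root is \<open>1 - m / l\<close> at
      \<mu> and \<open>0\<close> at \<open>L\<close>.\<close>
    moreover have "root_radius (ell a1 a0 b1 b0 \<eta>) \<le> 1 - m / l" if "\<eta> \<in> {\<mu>..L}" for \<eta>
      by (rule root_radius_interpolating_le[OF assms(1,2) nu0 int that,
            folded m_def l_def s_def])
         (use ml in \<open>simp_all add: s\<close>)
    ultimately show ?thesis
      unfolding kappa_agd using nu by (blast intro: quad_step_eq_agd_step)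
  qed
  have hb: "(\<forall>(A :: real^'d^'d) b. transpose A = A \<and> spectrum A \<subseteq> {\<mu>..L} \<longrightarrow>
        (\<forall>x x'. quad_step a1 a0 b1 b0 \<nu> A b x x' = hb_step L \<mu> (quad A b) x x')) \<and>
      (\<forall>\<eta>\<in>{\<mu>..L}. root_radius (ell a1 a0 b1 b0 \<eta>) \<le> (sqrt \<kappa> - 1) / (sqrt \<kappa> + 1))"
    if int: "interpolates \<mu> L \<nu> a1 a0 b1 b0" and nu: "\<nu> = - ((2 / (sqrt L + sqrt \<mu>))^2)"
    for a1 a0 b1 b0
  proof -
    have nu': "\<nu> = - (4 / (l + m)\<^sup>2)"
      by (simp add: nu l_def m_def power_divide)
    have s: "s = 2 / (m + l)"
      unfolding s_def nu using ml by (simp add: l_def m_def add.commute)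
    have "1 - 4 * l * m / (l + m)\<^sup>2 = ((l + m)\<^sup>2 - 4 * l * m) / (l + m)\<^sup>2"
      using nz by (simp add: diff_divide_distrib)
    also have "(l + m)\<^sup>2 - 4 * l * m = (l - m)\<^sup>2"
      by (simp add: power2_eq_square algebra_simps)
    finally have beta: "((l - m) / (l + m))\<^sup>2 = 1 - 4 * l * m / (l + m)\<^sup>2"
      by (simp add: power_divide)
    \<comment> \<open>Hence \<open>2 * s / (m + l) = - \<nu>\<close>, which cancels the two summands
      of \<open>a0\<close>.\<close>
    have "s / (m + l) = 2 / (l + m)\<^sup>2"
      by (simp add: s power2_eq_square add.commute)
    moreover have "a1 = - 2 * (s / (m + l))" "a0 = 2 * (s / (m + l)) + \<nu>"
      "b1 = 2 - 2 * (s / (m + l)) * l * m" "b0 = - 1 + 2 * (s / (m + l)) * l * m"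
      using int unfolding iff by (simp_all add: mult_ac)
    ultimately have "a1 = - (4 / (l + m)\<^sup>2)" "a0 = 0"
      "b1 = 1 + ((l - m) / (l + m))\<^sup>2" "b0 = - (((l - m) / (l + m))\<^sup>2)"
      unfolding beta by (simp_all add: nu')
    moreover have "root_radius (ell a1 a0 b1 b0 \<eta>) \<le> (l - m) / (l + m)" if "\<eta> \<in> {\<mu>..L}" for \<eta>
    proof -
      \<comment> \<open>This \<nu> balances the endpoints: the double roots there are opposite
        numbers of equal modulus.\<close>
      have "1 - s * m = (l - m) / (l + m)" "1 - s * l = - ((l - m) / (l + m))"
        using nz by (simp_all add: s field_simps)
      then show ?thesis
        by (intro root_radius_interpolating_le[OF assms(1,2) nu0 int that,
              folded m_def l_def s_def])
           (use ml in simp_all)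
    qed
    ultimately show ?thesis
      unfolding kappa_hb using nu' quad_step_eq_hb_step[folded l_def m_def, where L = L and \<mu> = \<mu>]
      by (auto simp: m_def l_def)
  qed
  have coeff: "a1 = - 2 * sqrt (- \<nu>) / (sqrt \<mu> + sqrt L)"
      "a0 = 2 * sqrt (- \<nu>) / (sqrt \<mu> + sqrt L) + \<nu>"
    if "interpolates \<mu> L \<nu> a1 a0 b1 b0" for a1 a0 b1 b0
    using that unfolding interpolates_iff[OF assms(1,2) nu0] by simp_all
  show ?thesis
    by (intro conjI[OF ex1] allI impI)
      (intro conjI[OF coeff(1) conjI[OF coeff(2) conjI]] impI agd hb; assumption)
qed

end
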